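(* Let $g(t,x)$ be a weak solution of the linear Boltzmann-type equation described in the context (with $\eta=1$), with microscopic interaction $x' = x + \lambda (x^{\alpha}(t,\vec{\mathbf y}) - x) + \sigma D(t,x,\vec{\mathbf y})\xi$ and initial datum $g_0$. Suppose that for every $\mathbf y\in E$ there are constants $\underline F(\mathbf y),\overline F(\mathbf y)\in\mathbb R$ with $\underline F(\mathbf y)\le F(x,\mathbf y)\le\overline F(\mathbf y)$ for all $x\in\mathbb R^d$, and that $$2\lambda-2(\lambda^2+\kappa\sigma^2)C_\alpha>0.$$ Let $\tilde x\in\mathbb R^d$ be the limit, as $t\to+\infty$, of the mean position $\int_{\mathbb R^d}x\,g(t,x)\,dx$. Consider the system of ordinary differential equations in $(m,V)\in\mathbb R^d\times\mathbb R$ $$\begin{cases}\dfrac{d}{dt}m(t)=-\lambda m(t)+\lambda\tilde x,\\[2mm]\dfrac{d}{dt}V(t)=\big((\lambda^2+\kappa\sigma^2)-2\lambda\big)V(t)+\dfrac{\lambda^2+\kappa\sigma^2}{2}|m(t)|^2-\dfrac{\lambda^2+\kappa\sigma^2}{2}|\tilde x|^2,\end{cases}$$ with initial conditions $m(0)=\int_{\mathbb R^d}x\,g_0(x)\,dx$ and $V(0)=\frac12\int_{\mathbb R^d}|x-m(0)|^2g_0(x)\,dx$. Then $(\tilde x,0)$ is the unique asymptotically stable equilibrium of this system with initial conditions $(m(0),V(0))$. In other words: (i) for every neighborhood $\mathcal O$ of $(\tilde x,0)$ there is a neighborhood $\mathcal O_1$ of $(\tilde x,0)$ in $\mathcal O$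 such that every solution $(m(t),V(t))$ with initial conditions $(m(0),V(0))$ in $\mathcal O_1$ is defined and remains in $\mathcal O$ for all $t>0$; and (ii) $\lim_{t\to\infty}(m(t),V(t))=(\tilde x,0)$.
   Context: Setting. $\mathbf Y$ is a random vector with values in $E\subset\mathbb R^k$. $F:\mathbb R^d\times E\to\mathbb R$ is such that, for each $x$, $F(x,\cdot)$ is measurable and $\mathbb E[F(x,\mathbf Y)]$ is finite. Fix $M\in\mathbb N$. For $\vec{\mathbf y}=(\mathbf y^{(1)},\dots,\mathbf y^{(M)})\in E^M$ let $\hat f_M(x,\vec{\mathbf y})=\frac1M\sum_{j=1}^MF(x,\mathbf y^{(j)})$. Samples $\vec{\mathbf y}$ of $M$ realizations of $\mathbf Y$ are drawn from a fixed probability law on $E^M$ with density $\theta$. Interaction. $\lambda,\sigma,\alpha>0$ are constants. Given a time-dependent probability density $g(t,\cdot)$ on $\mathbb R^d$, $$x^\alpha(t,\vec{\mathbf y})=\frac{\int_{\mathbb R^d}x\,e^{-\alpha\hat f_M(x,\vec{\mathbf y})}g(t,x)\,dx}{\int_{\mathbb R^d}e^{-\alpha\hat f_M(x,\vec{\mathbf y})}g(t,x)\,dx}.$$ The matrix $D(t,x,\vec{\mathbf y})\in\mathbb R^{d\times d}$ is either isotropic, $D=|x^\alpha(t,\vec{\mathbf y})-x|I_d$, in which case $\kappa:=d$, or anisotropic, $D=\operatorname{diag}(x^\alpha(t,\vec{\mathbf y})-x)$, in which case $\kappa:=1$. The vector $\xi\sim\mathcal N(0,I_d)$ is independent of $\vec{\mathbf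 y}$, and $\langle\cdot\rangle$ denotes expectation in $\xi$. The post-interaction position is $x'=x+\lambda(x^\alpha(t,\vec{\mathbf y})-x)+\sigma D(t,x,\vec{\mathbf y})\xi$. Weak solution (with interaction scale $\eta=1$). $g$ is a weak solution with initial datum $g_0$ (a probability density) if, for test functions $\psi$ and $t>0$, $$\frac{d}{dt}\int_{\mathbb R^d}\psi(x)g(t,x)\,dx=\int_{\mathbb R^d\times E^M}\langle\psi(x')-\psi(x)\rangle\,g(t,x)\,\theta(\vec{\mathbf y})\,dx\,d\vec{\mathbf y},$$ and $\lim_{t\to0}\int\psi(x)g(t,x)\,dx=\int\psi(x)g_0(x)\,dx$. Test functions are smooth, and $g$ is assumed to be sufficiently regular and integrable; in particular the identity may be used with $\psi(x)=x$ and $\psi(x)=|x|^2$, and first and second moments are finite and continuous up to $t=0$. Constant. $C_\alpha=\int_{E^M}e^{\alpha(\overline f_M(\vec{\mathbf y})-\underline f_M(\vec{\mathbf y}))}\theta(\vec{\mathbf y})\,d\vec{\mathbf y}>0$, assumed finite, where $\underline f_M(\vec{\mathbf y})=\frac1M\sum_{j=1}^M\underline F(\mathbf y^{(j)})$ and $\overline f_M(\vec{\mathbf y})=\frac1M\sum_{j=1}^M\overline F(\mathbf y^{(j)})$ (with $\underline F,\overline F$ measurable). Under the stated hypotheses the limit $\tilde x$ of the mean position exists (this is an earlier result in the source). *)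

theory Defs
  imports "HOL-Probability.Probability"
begin

section \<open>Probability densities and moments\<close>

definition prob_density_on :: "'a::euclidean_space set \<Rightarrow> ('a \<Rightarrow> real) \<Rightarrow> bool" where
  "prob_density_on S h \<longleftrightarrow>
     (\<forall>x\<in>S. 0 \<le> h x) \<and> set_integrable lborel S h \<and> (LINT x:S|lborel. h x) = 1"

definition mean_position :: "(real^'d \<Rightarrow> real) \<Rightarrow> real^'d" where
  "mean_position h = (LINT x|lborel. h x *\<^sub>R x)"

definition half_variance :: "(real^'d \<Rightarrow> real) \<Rightarrow> real" where
  "half_variance h = 1/2 * (LINT x|lborel. (norm (x - mean_position h))\<^sup>2 * h x)"

definition std_gaussian :: "(real^'d) measure" where
  "std_gaussian = density lborel (\<lambda>z. ennreal (\<Prod>i\<in>UNIV. std_normal_density (z $ i)))"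


section \<open>Microscopic interaction\<close>

text \<open>A sample of \<open>M\<close> realizations is a vector \<open>y :: real^'k^'m\<close> with \<open>M = CARD('m)\<close>;
  the \<open>j\<close>-th realization is \<open>y $ j\<close>.\<close>

definition sample_space :: "(real^'k) set \<Rightarrow> (real^'k^'m) set" where
  "sample_space E = {y. \<forall>j. y $ j \<in> E}"

definition sample_average :: "(real^'k \<Rightarrow> real) \<Rightarrow> real^'k^'m \<Rightarrow> real" where
  "sample_average h y = 1 / real CARD('m) * (\<Sum>j\<in>UNIV. h (y $ j))"

definition consensus_point ::
  "real \<Rightarrow> (real^'d \<Rightarrow> real^'k \<Rightarrow> real) \<Rightarrow> (real^'d \<Rightarrow> real) \<Rightarrow> real^'k^'m \<Rightarrow> real^'d" where
  "consensus_point \<alpha> F h y =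
     (LINT x|lborel. (exp (- \<alpha> * sample_average (F x) y) * h x) *\<^sub>R x) /\<^sub>R
     (LINT x|lborel. exp (- \<alpha> * sample_average (F x) y) * h x)"

datatype noise = Isotropic | Anisotropic

fun diffusion_matrix :: "noise \<Rightarrow> real^'d \<Rightarrow> real^'d^'d" where
  "diffusion_matrix Isotropic v = norm v *\<^sub>R mat 1"
| "diffusion_matrix Anisotropic v = (\<chi> i j. if i = j then v $ i else 0)"

fun noise_dim :: "noise \<Rightarrow> 'd::finite itself \<Rightarrow> real" where
  "noise_dim Isotropic _ = real CARD('d)"
| "noise_dim Anisotropic _ = 1"

definition post_interaction ::
  "noise \<Rightarrow> real \<Rightarrow> real \<Rightarrow> real^'d \<Rightarrow> real^'d \<Rightarrow> real^'d \<Rightarrow> real^'d" where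
  "post_interaction D lam \<sigma> c x \<xi> =
     x + lam *\<^sub>R (c - x) + \<sigma> *\<^sub>R (diffusion_matrix D (c - x) *v \<xi>)"

definition mean_increment ::
  "noise \<Rightarrow> real \<Rightarrow> real \<Rightarrow> (real^'d \<Rightarrow> real) \<Rightarrow> real^'d \<Rightarrow> real^'d \<Rightarrow> real" where
  "mean_increment D lam \<sigma> \<psi> c x =
     (LINT \<xi>|std_gaussian. \<psi> (post_interaction D lam \<sigma> c x \<xi>) - \<psi> x)"

definition growth_constant ::
  "real \<Rightarrow> (real^'k \<Rightarrow> real) \<Rightarrow> (real^'k \<Rightarrow> real) \<Rightarrow> (real^'k) set \<Rightarrow>
   (real^'k^'m \<Rightarrow> real) \<Rightarrow> real" where
  "growth_constant \<alpha> F_lo F_hi E \<theta> =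
     (LINT y:sample_space E|lborel.
        exp (\<alpha> * (sample_average F_hi y - sample_average F_lo y)) * \<theta> y)"


section \<open>Weak solutions\<close>

fun times_cont_differentiable :: "nat \<Rightarrow> ('a::real_normed_vector \<Rightarrow> real) \<Rightarrow> bool" where
  "times_cont_differentiable 0 \<psi> \<longleftrightarrow> continuous_on UNIV \<psi>"
| "times_cont_differentiable (Suc n) \<psi> \<longleftrightarrow>
     (\<forall>x. \<psi> differentiable (at x)) \<and>
     (\<forall>v. times_cont_differentiable n (\<lambda>x. frechet_derivative \<psi> (at x) v))"

text \<open>Compactly supported smooth functions, together with the coordinates of \<open>x\<close> and with
  \<open>|x|\<^sup>2\<close>, for which the weak formulation is assumed as well.\<close>

definition test_functions :: "(real^'d \<Rightarrow> real) set" where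
  "test_functions =
     {\<psi>. (\<forall>n. times_cont_differentiable n \<psi>) \<and> compact (closure {x. \<psi> x \<noteq> 0})} \<union>
     {\<psi>. \<exists>i. \<psi> = (\<lambda>x. x $ i)} \<union>
     {\<lambda>x. (norm x)\<^sup>2}"

text \<open>Bochner integrals are \<open>0\<close> for non-integrable functions, so the existence of the integrals
  that occur in the equation is required explicitly. As \<open>x\<close> and \<open>|x|\<^sup>2\<close> are test functions, the
  last two clauses also make the first and second moments continuous on \<open>[0,\<infinity>)\<close>.\<close>

definition weak_solution ::
  "noise \<Rightarrow> real \<Rightarrow> real \<Rightarrow> real \<Rightarrow> (real^'d \<Rightarrow> real^'k \<Rightarrow> real) \<Rightarrow> (real^'k) set \<Rightarrow>
   (real^'k^'m \<Rightarrow> real) \<Rightarrow> (real^'d \<Rightarrow> real) \<Rightarrow> (real \<Rightarrow> real^'d \<Rightarrow> real) \<Rightarrow> bool" where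
  "weak_solution D lam \<sigma> \<alpha> F E \<theta> g\<^sub>0 g \<longleftrightarrow>
     prob_density_on UNIV g\<^sub>0 \<and> integrable lborel (\<lambda>x. (norm x)\<^sup>2 * g\<^sub>0 x) \<and>
     (\<forall>t>0. prob_density_on UNIV (g t) \<and> integrable lborel (\<lambda>x. (norm x)\<^sup>2 * g t x)) \<and>
     (\<forall>t>0. \<forall>y\<in>sample_space E :: (real^'k^'m) set.
        integrable lborel (\<lambda>x. exp (- \<alpha> * sample_average (F x) y) * g t x) \<and>
        integrable lborel (\<lambda>x. (exp (- \<alpha> * sample_average (F x) y) * g t x) *\<^sub>R x)) \<and>
     (\<forall>\<psi>\<in>test_functions. \<forall>t>0.
        set_integrable lborel (UNIV \<times> sample_space E)
          (\<lambda>(x, y). mean_increment D lam \<sigma> \<psi> (consensus_point \<alpha> F (g t) y) x * g t x * \<theta> y) \<and>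
        ((\<lambda>s. LINT x|lborel. \<psi> x * g s x) has_real_derivative
           (LINT z:UNIV \<times> sample_space E|lborel.
              (case z of (x, y) \<Rightarrow>
                 mean_increment D lam \<sigma> \<psi> (consensus_point \<alpha> F (g t) y) x * g t x * \<theta> y))) (at t)) \<and>
     (\<forall>\<psi>\<in>test_functions.
        ((\<lambda>t. LINT x|lborel. \<psi> x * g t x) \<longlongrightarrow> (LINT x|lborel. \<psi> x * g\<^sub>0 x)) (at_right 0))"


section \<open>Autonomous ordinary differential equations\<close>

definition ode_solution ::
  "('a::real_normed_vector \<Rightarrow> 'a) \<Rightarrow> (real \<Rightarrow> 'a) \<Rightarrow> real set \<Rightarrow> bool" where
  "ode_solution f u J \<longleftrightarrow> (\<forall>t\<in>J. (u has_vector_derivative f (u t)) (at t within J))"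

text \<open>Functions are total, so ``every solution starting in \<open>N'\<close> is defined for all \<open>t > 0\<close>'' means:
  solutions exist on \<open>[0,\<infinity>)\<close>, and a solution on any forward time interval \<open>J\<close> extends to one.\<close>

definition stable_equilibrium :: "('a::real_normed_vector \<Rightarrow> 'a) \<Rightarrow> 'a \<Rightarrow> bool" where
  "stable_equilibrium f p \<longleftrightarrow>
     f p = 0 \<and>
     (\<forall>N. p \<in> interior N \<longrightarrow>
        (\<exists>N'\<subseteq>N. p \<in> interior N' \<and>
           (\<forall>q\<in>N'. \<exists>u. ode_solution f u {0..} \<and> u 0 = q) \<and>
           (\<forall>J u. is_interval J \<and> 0 \<in> J \<and> J \<subseteq> {0..} \<and> ode_solution f u J \<and> u 0 \<in> N' \<longrightarrow>
              (\<exists>v. ode_solution f v {0..} \<and> (\<forall>t\<in>J. v t = u t) \<and> (\<forall>t>0. v t \<in> N)))))"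

definition asymptotically_stable_equilibrium ::
  "('a::real_normed_vector \<Rightarrow> 'a) \<Rightarrow> 'a \<Rightarrow> bool" where
  "asymptotically_stable_equilibrium f p \<longleftrightarrow>
     stable_equilibrium f p \<and>
     (\<exists>N. p \<in> interior N \<and>
        (\<forall>u. ode_solution f u {0..} \<and> u 0 \<in> N \<longrightarrow> (u \<longlongrightarrow> p) at_top))"

text \<open>Right-hand side of the system for \<open>(m, V)\<close>, with \<open>\<kappa>\<close> the noise dimension.\<close>

definition moment_field ::
  "real \<Rightarrow> real \<Rightarrow> real \<Rightarrow> real^'d \<Rightarrow> (real^'d) \<times> real \<Rightarrow> (real^'d) \<times> real" where
  "moment_field lam \<sigma> \<kappa> xt = (\<lambda>(m, V).
     (- lam *\<^sub>R m + lam *\<^sub>R xt,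
      ((lam\<^sup>2 + \<kappa> * \<sigma>\<^sup>2) - 2 * lam) * V
        + (lam\<^sup>2 + \<kappa> * \<sigma>\<^sup>2) / 2 * (norm m)\<^sup>2 - (lam\<^sup>2 + \<kappa> * \<sigma>\<^sup>2) / 2 * (norm xt)\<^sup>2))"

end

theory Submission
  imports Defs
begin

text \<open>
  Put \<open>A = \<lambda>\<^sup>2 + \<kappa> \<sigma>\<^sup>2\<close>. Since \<open>\<theta>\<close> is a probability density and the exponential weight
  in the growth constant \<open>C\<close> is at least \<open>1\<close>, one has \<open>C \<ge> 1\<close>
  (\<open>growth_constant_ge_1\<close>), so the hypothesis \<open>2 \<lambda> - 2 A C > 0\<close> forces \<open>A < \<lambda>\<close>.

  The system for \<open>(m, V)\<close> is conjugate to a decoupled linear one. With \<open>w = m - xt\<close> it reads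
  \<open>w' = - \<lambda> w\<close> and \<open>V' = - b V + A (|w|\<^sup>2 / 2 + w \<bullet> xt)\<close>, where \<open>b = 2 \<lambda> - A > 0\<close>. The forcing
  can be absorbed into \<open>V\<close>: along solutions \<open>|w|\<^sup>2\<close> decays at rate \<open>2 \<lambda>\<close> and \<open>w \<bullet> xt\<close> at rate
  \<open>\<lambda>\<close>, and neither equals \<open>b\<close> (there is no resonance), because \<open>2 \<lambda> - b = A\<close> and
  \<open>b - \<lambda> = \<lambda> - A > 0\<close>. Solving for the coefficients, the quantity
  \<open>z = V + |w|\<^sup>2 / 2 - (A / (\<lambda> - A)) (w \<bullet> xt)\<close> satisfies \<open>z' = - b z\<close>
  (\<open>straighten_derivative\<close>).

  The map \<open>(m, V) \<mapsto> (w, z)\<close> is a homeomorphism that sends \<open>(xt, 0)\<close> to \<open>0\<close>, and in the new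
  coordinates every solution is \<open>(exp (- \<lambda> t) w\<^sub>0, exp (- b t) z\<^sub>0)\<close>, on whichever interval it is
  defined (\<open>solution_eq_flow\<close>). Hence solutions extend to all of \<open>[0, \<infinity>)\<close>, the distance to
  \<open>0\<close> never increases, which gives stability, and it tends to \<open>0\<close>, which gives attraction from
  every initial state, in particular from the moments of the initial datum.
\<close>

section \<open>Linear decay\<close>

text \<open>Multiplying by \<open>exp (k s)\<close> produces a function with zero derivative. Allowing an arbitrary
  interval \<open>J\<close> is what lets solutions given only on part of \<open>[0, \<infinity>)\<close> be extended later.\<close>

lemma linear_decay_unique:
  fixes w :: "real \<Rightarrow> 'a::real_normed_vector"
  assumes J: "is_interval J" "0 \<in> J" "t \<in> J"
    and w: "\<And>s. s \<in> J \<Longrightarrow> (w has_vector_derivative (- k) *\<^sub>R w s) (at s within J)"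
  shows "w t = exp (- k * t) *\<^sub>R w 0"
proof -
  let ?v = "\<lambda>s. exp (k * s) *\<^sub>R w s"
  have "(?v has_derivative (\<lambda>h. 0)) (at s within J)" if "s \<in> J" for s
    using w[OF that] unfolding has_vector_derivative_def
    by (auto intro!: derivative_eq_intros simp: algebra_simps)
  then have "\<exists>c. \<forall>s\<in>J. ?v s = c"
    using J(1) by (intro has_derivative_zero_constant) (auto simp: is_interval_convex)
  then have "?v t = ?v 0"
    using J by metis
  then have "exp (- k * t) *\<^sub>R ?v t = exp (- k * t) *\<^sub>R w 0"
    by simp
  then show ?thesis
    by (simp flip: exp_add)
qed

lemma linear_decay_derivative:
  fixes w :: "'a::real_normed_vector"
  shows "((\<lambda>s. exp (- k * s) *\<^sub>R w) has_vector_derivative (- k) *\<^sub>R exp (- k * t) *\<^sub>R w)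
    (at t within J)"
  unfolding has_vector_derivative_def
  by (auto intro!: derivative_eq_intros simp: algebra_simps)

lemma exp_decay_tendsto_0:
  fixes w :: "'a::real_normed_vector"
  assumes "k > 0"
  shows "((\<lambda>t. exp (- k * t) *\<^sub>R w) \<longlongrightarrow> 0) at_top"
proof -
  have "filterlim (\<lambda>t. - k * t) at_bot at_top"
    using assms by (intro filterlim_tendsto_neg_mult_at_bot[OF tendsto_const _ filterlim_ident]) auto
  then have "((\<lambda>t. exp (- k * t)) \<longlongrightarrow> 0) at_top"
    by (rule filterlim_compose[OF exp_at_bot])
  then show ?thesis
    by (auto dest: tendsto_scaleR[OF _ tendsto_const[of w]])
qed

section \<open>The moment system in straightened coordinates\<close>

locale contracting_moment_system =
  fixes lam \<sigma> \<kappa> :: real and xt :: "real^'d"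
  assumes lam_pos: "0 < lam" and contraction: "lam\<^sup>2 + \<kappa> * \<sigma>\<^sup>2 < lam"
begin

definition gain :: real where
  "gain = lam\<^sup>2 + \<kappa> * \<sigma>\<^sup>2"

text \<open>Decay rate of \<open>V\<close> in the absence of forcing.\<close>

definition decay :: real where
  "decay = 2 * lam - gain"

text \<open>Coefficient that removes the forcing term \<open>gain * (w \<bullet> xt)\<close>: it is the solution of
  \<open>gain + lam * shear = decay * shear\<close>.\<close>

definition shear :: real where
  "shear = gain / (lam - gain)"

text \<open>What has to be added to \<open>V\<close> in order to cancel the forcing by \<open>w = m - xt\<close>.\<close>

definition correction :: "real^'d \<Rightarrow> real" where
  "correction w = w \<bullet> w / 2 - shear * (w \<bullet> xt)"

definition straighten :: "(real^'d) \<times> real \<Rightarrow> (real^'d) \<times> real" where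
  "straighten = (\<lambda>(m, V). (m - xt, V + correction (m - xt)))"

definition unstraighten :: "(real^'d) \<times> real \<Rightarrow> (real^'d) \<times> real" where
  "unstraighten = (\<lambda>(w, z). (xt + w, z - correction w))"

definition flow :: "(real^'d) \<times> real \<Rightarrow> real \<Rightarrow> (real^'d) \<times> real" where
  "flow q t = unstraighten
     (exp (- lam * t) *\<^sub>R fst (straighten q), exp (- decay * t) *\<^sub>R snd (straighten q))"

lemma gain_less: "gain < lam"
  using contraction by (simp add: gain_def)

lemma decay_pos: "0 < decay"
  using gain_less lam_pos by (simp add: decay_def)

lemma shear_eq: "gain + lam * shear = decay * shear"
  using gain_less by (simp add: shear_def decay_def field_simps)

lemma unstraighten_straighten [simp]: "unstraighten (straighten q) = q"
  by (simp add: straighten_def unstraighten_def split_beta)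

lemma straighten_unstraighten [simp]: "straighten (unstraighten q) = q"
  by (simp add: straighten_def unstraighten_def split_beta)

lemma straighten_equilibrium [simp]: "straighten (xt, 0) = 0"
  by (simp add: straighten_def correction_def zero_prod_def)

lemma unstraighten_0 [simp]: "unstraighten 0 = (xt, 0)"
  by (simp add: unstraighten_def correction_def zero_prod_def)

lemma continuous_straighten: "continuous_on UNIV straighten"
  unfolding straighten_def correction_def split_beta by (intro continuous_intros) auto

lemma continuous_unstraighten: "continuous_on UNIV unstraighten"
  unfolding unstraighten_def correction_def split_beta by (intro continuous_intros) auto

text \<open>The vector field centred at the equilibrium, by \<open>|m|\<^sup>2 - |xt|\<^sup>2 = |w|\<^sup>2 + 2 (w \<bullet> xt)\<close>.\<close>

lemma moment_field_eq:
  "moment_field lam \<sigma> \<kappa> xt (xt + w, V) =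
     (- lam *\<^sub>R w, - decay * V + gain * (w \<bullet> w / 2 + w \<bullet> xt))"
  unfolding moment_field_def power2_norm_eq_inner gain_def[symmetric] decay_def
  by (simp add: algebra_simps inner_commute)

lemma moment_field_zero_iff: "moment_field lam \<sigma> \<kappa> xt p = 0 \<longleftrightarrow> p = (xt, 0)"
  using lam_pos decay_pos moment_field_eq[of "fst p - xt" "snd p"]
  by (cases p) (auto simp: zero_prod_def)

text \<open>The correction obeys the same linear law as \<open>V\<close>, but with the forcing of opposite sign. For
  the quadratic part this uses \<open>2 * lam = decay + gain\<close>, for the linear part the equation that
  defines \<open>shear\<close>. Both directions of the conjugacy rest on this computation.\<close>

lemma correction_derivative:
  assumes w: "(w has_vector_derivative - lam *\<^sub>R w t) (at t within J)"
  shows "((\<lambda>s. correction (w s)) has_real_derivative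
    - decay * correction (w t) - gain * (w t \<bullet> w t / 2 + w t \<bullet> xt)) (at t within J)"
proof -
  have "((\<lambda>s. w s \<bullet> w s) has_real_derivative - 2 * lam * (w t \<bullet> w t)) (at t within J)"
    using bounded_bilinear.has_vector_derivative[OF bounded_bilinear_inner w w]
    by (simp add: has_real_derivative_iff_has_vector_derivative mult.assoc)
  moreover have "((\<lambda>s. w s \<bullet> xt) has_real_derivative - lam * (w t \<bullet> xt)) (at t within J)"
    using bounded_linear.has_vector_derivative[OF bounded_linear_inner_left w]
    by (simp add: has_real_derivative_iff_has_vector_derivative)
  ultimately have "((\<lambda>s. correction (w s)) has_real_derivative
      - 2 * lam * (w t \<bullet> w t) / 2 - shear * (- lam * (w t \<bullet> xt))) (at t within J)"
    unfolding correction_def by (intro DERIV_diff DERIV_cdivide DERIV_cmult)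
  moreover have "- 2 * lam * (w t \<bullet> w t) / 2 - shear * (- lam * (w t \<bullet> xt)) =
      - (decay + gain) * (w t \<bullet> w t / 2) + (gain + lam * shear) * (w t \<bullet> xt) - gain * (w t \<bullet> xt)"
    by (simp add: decay_def algebra_simps)
  moreover have "\<dots> = - decay * correction (w t) - gain * (w t \<bullet> w t / 2 + w t \<bullet> xt)"
    unfolding shear_eq by (simp add: correction_def algebra_simps)
  ultimately show ?thesis
    by simp
qed

text \<open>Adding the equations of \<open>V\<close> and of the correction cancels the forcing.\<close>

lemma straighten_derivative:
  assumes "(u has_vector_derivative moment_field lam \<sigma> \<kappa> xt (u t)) (at t within J)"
  shows "((\<lambda>s. fst (straighten (u s))) has_vector_derivative (- lam) *\<^sub>R fst (straighten (u t)))
          (at t within J)"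
    and "((\<lambda>s. snd (straighten (u s))) has_vector_derivative (- decay) *\<^sub>R snd (straighten (u t)))
          (at t within J)"
proof -
  let ?w = "\<lambda>s. fst (u s) - xt" and ?V = "\<lambda>s. snd (u s)"
  let ?V' = "- decay * ?V t + gain * (?w t \<bullet> ?w t / 2 + ?w t \<bullet> xt)"
  have u': "(u has_vector_derivative (- lam *\<^sub>R ?w t, ?V')) (at t within J)"
    using assms moment_field_eq[of "?w t" "?V t"] by simp
  have w: "(?w has_vector_derivative - lam *\<^sub>R ?w t) (at t within J)"
    using bounded_linear.has_vector_derivative[OF bounded_linear_fst u']
    by (auto intro!: derivative_eq_intros)
  have "(?V has_real_derivative ?V') (at t within J)"
    using bounded_linear.has_vector_derivative[OF bounded_linear_snd u']
    by (simp add: has_real_derivative_iff_has_vector_derivative)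
  from DERIV_add[OF this correction_derivative[OF w]]
  show "((\<lambda>s. snd (straighten (u s))) has_vector_derivative (- decay) *\<^sub>R snd (straighten (u t)))
          (at t within J)"
    by (simp add: straighten_def split_beta algebra_simps
          flip: has_real_derivative_iff_has_vector_derivative)
  show "((\<lambda>s. fst (straighten (u s))) has_vector_derivative (- lam) *\<^sub>R fst (straighten (u t)))
          (at t within J)"
    using w by (simp add: straighten_def split_beta)
qed

lemma flow_0 [simp]: "flow q 0 = q"
  by (simp add: flow_def)

text \<open>Conversely, curves that decay linearly in the straightened coordinates solve the system:
  subtracting the correction puts the forcing back.\<close>

lemma flow_solution: "ode_solution (moment_field lam \<sigma> \<kappa> xt) (flow q) J"
  unfolding ode_solution_def
proof
  fix t
  define w where "w s = exp (- lam * s) *\<^sub>R fst (straighten q)" for s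
  define z where "z s = exp (- decay * s) *\<^sub>R snd (straighten q)" for s
  have flow: "flow q s = (xt + w s, z s - correction (w s))" for s
    by (simp add: flow_def unstraighten_def w_def z_def)
  have w: "(w has_vector_derivative - lam *\<^sub>R w t) (at t within J)"
    using linear_decay_derivative unfolding w_def[abs_def] by metis
  then have m: "((\<lambda>s. xt + w s) has_vector_derivative - lam *\<^sub>R w t) (at t within J)"
    by (auto intro!: derivative_eq_intros)
  have "(z has_real_derivative - decay * z t) (at t within J)"
    using linear_decay_derivative[of decay "snd (straighten q)" t J]
    by (simp add: z_def[abs_def] has_real_derivative_iff_has_vector_derivative)
  from DERIV_diff[OF this correction_derivative[OF w]]
  have V: "((\<lambda>s. z s - correction (w s)) has_vector_derivative
      - decay * (z t - correction (w t)) + gain * (w t \<bullet> w t / 2 + w t \<bullet> xt)) (at t within J)"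
    by (simp add: algebra_simps has_real_derivative_iff_has_vector_derivative)
  show "(flow q has_vector_derivative moment_field lam \<sigma> \<kappa> xt (flow q t)) (at t within J)"
    using has_vector_derivative_Pair[OF m V]
    unfolding flow moment_field_eq by (simp add: flow[abs_def])
qed

lemma solution_eq_flow:
  assumes "ode_solution (moment_field lam \<sigma> \<kappa> xt) u J" "is_interval J" "0 \<in> J" "t \<in> J"
  shows "u t = flow (u 0) t"
proof -
  have u: "(u has_vector_derivative moment_field lam \<sigma> \<kappa> xt (u s)) (at s within J)" if "s \<in> J" for s
    using assms(1) that by (simp add: ode_solution_def)
  have "fst (straighten (u t)) = exp (- lam * t) *\<^sub>R fst (straighten (u 0))"
    using assms(2-4) straighten_derivative(1)[OF u] by (rule linear_decay_unique)
  moreover have "snd (straighten (u t)) = exp (- decay * t) *\<^sub>R snd (straighten (u 0))"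
    using assms(2-4) straighten_derivative(2)[OF u] by (rule linear_decay_unique)
  ultimately have "flow (u 0) t = unstraighten (straighten (u t))"
    unfolding flow_def by (metis prod.collapse)
  then show ?thesis
    by simp
qed

lemma flow_tendsto: "(flow q \<longlongrightarrow> (xt, 0)) at_top"
proof -
  have "isCont unstraighten 0"
    using continuous_unstraighten by (metis UNIV_I continuous_on_eq_continuous_at open_UNIV)
  moreover have "((\<lambda>t. (exp (- lam * t) *\<^sub>R fst (straighten q),
      exp (- decay * t) *\<^sub>R snd (straighten q))) \<longlongrightarrow> 0) at_top"
    unfolding zero_prod_def
    by (intro tendsto_Pair exp_decay_tendsto_0 lam_pos decay_pos)
  ultimately have "(flow q \<longlongrightarrow> unstraighten 0) at_top"
    unfolding flow_def[abs_def] by (rule isCont_tendsto_compose)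
  then show ?thesis
    by simp
qed

lemma solution_tendsto:
  assumes "ode_solution (moment_field lam \<sigma> \<kappa> xt) u {0..}"
  shows "(u \<longlongrightarrow> (xt, 0)) at_top"
proof (rule tendsto_cong[THEN iffD1, OF _ flow_tendsto])
  show "\<forall>\<^sub>F t in at_top. flow (u 0) t = u t"
    using eventually_ge_at_top[of 0]
    by (rule eventually_mono) (rule solution_eq_flow[OF assms is_interval_ci, symmetric], auto)
qed

text \<open>In the straightened coordinates the Euclidean norm is a Lyapunov function.\<close>

lemma norm_straighten_flow_le:
  assumes "0 \<le> t"
  shows "norm (straighten (flow q t)) \<le> norm (straighten q)"
proof -
  obtain w z where q: "straighten q = (w, z)"
    by fastforce
  have "norm (exp (- lam * t) *\<^sub>R w) \<le> norm w" "norm (exp (- decay * t) *\<^sub>R z) \<le> norm z"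
    using assms lam_pos decay_pos by (auto simp: abs_mult intro!: mult_left_le_one_le)
  then show ?thesis
    unfolding flow_def straighten_unstraighten q fst_conv snd_conv norm_Pair
    by (intro real_sqrt_le_mono add_mono power_mono) auto
qed

text \<open>Balls around \<open>0\<close> in the straightened coordinates are forward invariant, and their preimages
  form a neighbourhood basis of the equilibrium.\<close>

lemma stable: "stable_equilibrium (moment_field lam \<sigma> \<kappa> xt) (xt, 0)"
  unfolding stable_equilibrium_def
proof (intro conjI allI impI)
  show "moment_field lam \<sigma> \<kappa> xt (xt, 0) = 0"
    by (simp add: moment_field_zero_iff)
next
  fix N :: "((real^'d) \<times> real) set"
  assume N: "(xt, 0) \<in> interior N"
  have "open (unstraighten -` interior N)"
    using continuous_unstraighten by (simp add: continuous_on_open_vimage)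
  then obtain \<delta> where \<delta>: "\<delta> > 0" "ball 0 \<delta> \<subseteq> unstraighten -` interior N"
    using N by (metis open_contains_ball unstraighten_0 vimage_eq)
  let ?N' = "straighten -` ball 0 \<delta>"
  have sub: "?N' \<subseteq> N"
  proof
    fix q assume "q \<in> ?N'"
    then have "unstraighten (straighten q) \<in> interior N"
      using \<delta>(2) by blast
    then show "q \<in> N"
      using interior_subset by auto
  qed
  have "open ?N'"
    using continuous_straighten by (simp add: continuous_on_open_vimage)
  then have int: "(xt, 0) \<in> interior ?N'"
    using \<delta>(1) by (simp add: interior_open)
  have stay: "flow q t \<in> N" if "q \<in> ?N'" "0 \<le> t" for q t
    using that norm_straighten_flow_le[of t q] sub by fastforce
  show "\<exists>N'\<subseteq>N. (xt, 0) \<in> interior N' \<and>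
      (\<forall>q\<in>N'. \<exists>u. ode_solution (moment_field lam \<sigma> \<kappa> xt) u {0..} \<and> u 0 = q) \<and>
      (\<forall>J u. is_interval J \<and> 0 \<in> J \<and> J \<subseteq> {0..} \<and>
          ode_solution (moment_field lam \<sigma> \<kappa> xt) u J \<and> u 0 \<in> N' \<longrightarrow>
        (\<exists>v. ode_solution (moment_field lam \<sigma> \<kappa> xt) v {0..} \<and> (\<forall>t\<in>J. v t = u t) \<and>
          (\<forall>t>0. v t \<in> N)))"
  proof (intro exI[of _ ?N'] conjI sub int ballI allI impI)
    fix q
    show "\<exists>u. ode_solution (moment_field lam \<sigma> \<kappa> xt) u {0..} \<and> u 0 = q"
      using flow_solution flow_0 by blast
  next
    fix J u
    assume *: "is_interval J \<and> 0 \<in> J \<and> J \<subseteq> {0..} \<and>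
      ode_solution (moment_field lam \<sigma> \<kappa> xt) u J \<and> u 0 \<in> ?N'"
    then have "\<forall>t\<in>J. flow (u 0) t = u t"
      using solution_eq_flow by metis
    then show "\<exists>v. ode_solution (moment_field lam \<sigma> \<kappa> xt) v {0..} \<and> (\<forall>t\<in>J. v t = u t) \<and>
        (\<forall>t>0. v t \<in> N)"
      using * stay flow_solution by (intro exI[of _ "flow (u 0)"]) auto
  qed
qed

lemma asymptotically_stable:
  "asymptotically_stable_equilibrium (moment_field lam \<sigma> \<kappa> xt) (xt, 0)"
proof -
  have "(xt, 0) \<in> interior (UNIV :: ((real^'d) \<times> real) set)"
    by simp
  then show ?thesis
    unfolding asymptotically_stable_equilibrium_def using stable solution_tendsto by blast
qed

end

section \<open>The growth constant\<close>

text \<open>The growth constant is the mean of a weight \<open>\<ge> 1\<close> under the probability density \<open>\<theta>\<close>.\<close>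

lemma growth_constant_ge_1:
  fixes \<theta> :: "real^'k^'m \<Rightarrow> real"
  assumes \<theta>: "prob_density_on (sample_space E) \<theta>"
    and int: "set_integrable lborel (sample_space E)
      (\<lambda>y. exp (\<alpha> * (sample_average F_hi y - sample_average F_lo y)) * \<theta> y)"
    and "0 \<le> \<alpha>" and le: "\<And>y. y \<in> E \<Longrightarrow> F_lo y \<le> F_hi y"
  shows "1 \<le> growth_constant \<alpha> F_lo F_hi E \<theta>"
proof -
  have le_tilted: "\<theta> y \<le> exp (\<alpha> * (sample_average F_hi y - sample_average F_lo y)) * \<theta> y"
    if "y \<in> sample_space E" for y
  proof -
    have "sample_average F_lo y \<le> sample_average F_hi y"
      using that le unfolding sample_average_def sample_space_def
      by (intro mult_left_mono sum_mono) auto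
    then have "1 \<le> exp (\<alpha> * (sample_average F_hi y - sample_average F_lo y))"
      using \<open>0 \<le> \<alpha>\<close> by simp
    moreover have "0 \<le> \<theta> y"
      using \<theta> that by (simp add: prob_density_on_def)
    ultimately show ?thesis
      using mult_right_mono by fastforce
  qed
  have "(LINT y:sample_space E|lborel. \<theta> y) \<le> growth_constant \<alpha> F_lo F_hi E \<theta>"
    using \<theta> int le_tilted unfolding growth_constant_def prob_density_on_def
    by (blast intro: set_integral_mono)
  then show ?thesis
    using \<theta> by (simp add: prob_density_on_def)
qed

section \<open>Stability of the consensus state\<close>

theorem corollary2p8:
  fixes P :: "'w measure" and Y :: "'w \<Rightarrow> real^'k" and E :: "(real^'k) set"
    and F :: "real^'d \<Rightarrow> real^'k \<Rightarrow> real" and F_lo F_hi :: "real^'k \<Rightarrow> real"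
    and \<theta> :: "real^'k^'m \<Rightarrow> real" and D :: noise and lam \<sigma> \<alpha> \<kappa> :: real
    and g\<^sub>0 :: "real^'d \<Rightarrow> real" and g :: "real \<Rightarrow> real^'d \<Rightarrow> real" and xt :: "real^'d"
  assumes "prob_space P" and "Y \<in> P \<rightarrow>\<^sub>M restrict_space borel E"
    and "\<And>x. F x \<in> borel_measurable (restrict_space borel E)"
    and "\<And>x. integrable P (\<lambda>\<omega>. F x (Y \<omega>))"
    and "prob_density_on (sample_space E) \<theta>"
    and "lam > 0" and "\<sigma> > 0" and "\<alpha> > 0"
    and "\<kappa> = noise_dim D TYPE('d)"
    and "weak_solution D lam \<sigma> \<alpha> F E \<theta> g\<^sub>0 g"
    and "F_lo \<in> borel_measurable (restrict_space borel E)"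
    and "F_hi \<in> borel_measurable (restrict_space borel E)"
    and "\<And>x y. y \<in> E \<Longrightarrow> F_lo y \<le> F x y \<and> F x y \<le> F_hi y"
    and "set_integrable lborel (sample_space E)
           (\<lambda>y. exp (\<alpha> * (sample_average F_hi y - sample_average F_lo y)) * \<theta> y)"
    and "2 * lam - 2 * (lam\<^sup>2 + \<kappa> * \<sigma>\<^sup>2) * growth_constant \<alpha> F_lo F_hi E \<theta> > 0"
    and "((\<lambda>t. mean_position (g t)) \<longlongrightarrow> xt) at_top"
  shows "asymptotically_stable_equilibrium (moment_field lam \<sigma> \<kappa> xt) (xt, 0) \<and>
    (\<forall>p. moment_field lam \<sigma> \<kappa> xt p = 0 \<longrightarrow> p = (xt, 0)) \<and>
    (\<exists>u. ode_solution (moment_field lam \<sigma> \<kappa> xt) u {0..} \<and>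
         u 0 = (mean_position g\<^sub>0, half_variance g\<^sub>0)) \<and>
    (\<forall>u. ode_solution (moment_field lam \<sigma> \<kappa> xt) u {0..} \<and>
         u 0 = (mean_position g\<^sub>0, half_variance g\<^sub>0) \<longrightarrow> (u \<longlongrightarrow> (xt, 0)) at_top)"
proof -
  let ?A = "lam\<^sup>2 + \<kappa> * \<sigma>\<^sup>2" and ?C = "growth_constant \<alpha> F_lo F_hi E \<theta>"
  have "0 \<le> \<kappa>"
    using assms(9) by (cases D) auto
  then have "0 \<le> ?A"
    by simp
  have "F_lo y \<le> F_hi y" if "y \<in> E" for y
    using assms(13)[OF that] order_trans by blast
  then have "1 \<le> ?C"
    using assms(5,8,14) by (intro growth_constant_ge_1) auto
  then have "?A * 1 \<le> ?A * ?C"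
    using \<open>0 \<le> ?A\<close> by (rule mult_left_mono)
  moreover have "?A * ?C < lam"
    using assms(15) by (simp only: mult.assoc)
  ultimately have "?A < lam"
    by simp
  then interpret contracting_moment_system lam \<sigma> \<kappa> xt
    using assms(6) by unfold_locales
  show ?thesis
    using asymptotically_stable moment_field_zero_iff solution_tendsto flow_solution flow_0
    by blast
qed

end
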